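(* Let $\kappa\ge 2$ be an integer and let $(\alpha_p,\alpha_e)\in\mathbb{R}^2$. For any $\rho\in(0,1)$ and any $\mathcal{E}\in(\rho,\kappa\rho)$, the Jacobian matrix $\mathbf{J}(\rho,\mathcal{E})$ of the macroscopic current $\mathbf{j}$ is diagonalizable with real eigenvalues. Under the additional condition $(\alpha_p,\alpha_e)\neq(0,0)$, these eigenvalues are distinct. Moreover, if $u$ and $v$ are two left eigenvectors (row vectors) of $\mathbf{J}(\rho,\mathcal{E})$ associated with distinct eigenvalues, then $$u\,\chi(\rho,\mathcal{E})\,v^\top=0.$$
   Context: For $\rho\in(0,1)$ and $\mathcal{E}\in(\rho,\kappa\rho)$, the compressibility matrix is the symmetric positive definite matrix $$\chi(\rho,\mathcal{E})=\begin{pmatrix}\rho(1-\rho)&\mathcal{E}(1-\rho)\\ \mathcal{E}(1-\rho)&\frac{(\mathcal{E}-\rho)(\kappa\rho-\mathcal{E})}{(\kappa-1)\rho}+\frac{(1-\rho)\mathcal{E}^2}{\rho}\end{pmatrix}.$$ (It is the covariance matrix of $(\mathbf 1_{\{\eta\ge1\}},\eta)$ when $\eta\in\{0,\dots,\kappa\}$ is $0$ with probability $1-\rho$ and, with probability $\rho$, $\eta-1$ is Binomial with parameters $\kappa-1$ and $\mathtt p=\frac{\mathcal{E}/\rho-1}{\kappa-1}$.) The macroscopic current is $$\mathbf{j}(\rho,\mathcal{E})=(\kappa-1)\,\chi(\rho,\mathcal{E})\begin{pmatrix}\alpha_p\\ \alpha_e\end{pmatrix}\in\mathbb{R}^2,$$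 and $\mathbf{J}(\rho,\mathcal{E})$ is its $2\times2$ Jacobian matrix with respect to $(\rho,\mathcal{E})$, i.e. $\mathbf{J}_{i1}=\partial_\rho\mathbf{j}_i$, $\mathbf{J}_{i2}=\partial_{\mathcal{E}}\mathbf{j}_i$. A left eigenvector is a nonzero row vector $u$ with $u\mathbf{J}=\lambda u$. *)

theory Defs
  imports "HOL-Analysis.Analysis"
begin

definition compressibility :: "nat \<Rightarrow> real \<Rightarrow> real \<Rightarrow> real^2^2" where
  "compressibility \<kappa> \<rho> \<E> = vector
     [vector [\<rho> * (1 - \<rho>), \<E> * (1 - \<rho>)],
      vector [\<E> * (1 - \<rho>),
              (\<E> - \<rho>) * (real \<kappa> * \<rho> - \<E>) / ((real \<kappa> - 1) * \<rho>) + (1 - \<rho>) * \<E>\<^sup>2 / \<rho>]]"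

definition macroscopic_current :: "nat \<Rightarrow> real \<Rightarrow> real \<Rightarrow> real \<Rightarrow> real \<Rightarrow> real^2" where
  "macroscopic_current \<kappa> \<alpha>p \<alpha>e \<rho> \<E> =
     (real \<kappa> - 1) *\<^sub>R (compressibility \<kappa> \<rho> \<E> *v vector [\<alpha>p, \<alpha>e])"

definition current_jacobian :: "nat \<Rightarrow> real \<Rightarrow> real \<Rightarrow> real \<Rightarrow> real \<Rightarrow> real^2^2" where
  "current_jacobian \<kappa> \<alpha>p \<alpha>e \<rho> \<E> =
     jacobian (\<lambda>x. macroscopic_current \<kappa> \<alpha>p \<alpha>e (x $ 1) (x $ 2)) (at (vector [\<rho>, \<E>]))"

text \<open>Diagonalizability is over the field of the matrix entries. For a real matrix it
  therefore includes the requirement that all eigenvalues are real.\<close>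

definition diagonalizable :: "'a::field^'n^'n \<Rightarrow> bool" where
  "diagonalizable A \<longleftrightarrow>
     (\<exists>P D :: 'a^'n^'n. invertible P \<and> (\<forall>i j. i \<noteq> j \<longrightarrow> D $ i $ j = 0) \<and> A = P ** D ** matrix_inv P)"

definition eigenvalue :: "'a::field^'n^'n \<Rightarrow> 'a \<Rightarrow> bool" where
  "eigenvalue A l \<longleftrightarrow> (\<exists>x. x \<noteq> 0 \<and> A *v x = l *s x)"

definition left_eigenvector :: "'a::field^'n^'n \<Rightarrow> 'a^'n \<Rightarrow> 'a \<Rightarrow> bool" where
  "left_eigenvector A u l \<longleftrightarrow> u \<noteq> 0 \<and> u v* A = l *s u"

text \<open>The library's \<^const>\<open>jacobian\<close> is only meaningful where the function is
  differentiable. This is the case here, and its entries are the partial derivatives.\<close>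

lemma macroscopic_current_differentiable:
  assumes "\<rho> \<noteq> 0" "\<kappa> \<ge> 2"
  shows "(\<lambda>x::real^2. macroscopic_current \<kappa> \<alpha>p \<alpha>e (x $ 1) (x $ 2)) differentiable (at (vector [\<rho>, \<E>]))"
proof -
  have d: "(\<lambda>x::real^2. x $ k) differentiable F" for k F
    by (intro bounded_linear_imp_differentiable bounded_linear_vec_nth)
  have "(\<lambda>x::real^2. macroscopic_current \<kappa> \<alpha>p \<alpha>e (x $ 1) (x $ 2) $ i)
      differentiable (at (vector [\<rho>, \<E>]))" for i
    using exhaust_2[of i] assms
    by (auto simp: macroscopic_current_def compressibility_def matrix_vector_mult_def sum_2
      intro!: derivative_intros d)
  then show ?thesis
    by (subst differentiable_componentwise_within)
       (auto simp: Basis_vec_def inner_axis)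
qed

lemma current_jacobian_partial:
  assumes "\<rho> \<noteq> 0" "\<kappa> \<ge> 2"
  shows "((\<lambda>r. macroscopic_current \<kappa> \<alpha>p \<alpha>e r \<E> $ i)
           has_real_derivative current_jacobian \<kappa> \<alpha>p \<alpha>e \<rho> \<E> $ i $ 1) (at \<rho>)"
    and "((\<lambda>e. macroscopic_current \<kappa> \<alpha>p \<alpha>e \<rho> e $ i)
           has_real_derivative current_jacobian \<kappa> \<alpha>p \<alpha>e \<rho> \<E> $ i $ 2) (at \<E>)"
proof -
  let ?f = "\<lambda>x::real^2. macroscopic_current \<kappa> \<alpha>p \<alpha>e (x $ 1) (x $ 2)"
  let ?J = "current_jacobian \<kappa> \<alpha>p \<alpha>e \<rho> \<E>"
  have "(?f has_derivative (\<lambda>h. ?J *v h)) (at (vector [\<rho>, \<E>]))"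
    using macroscopic_current_differentiable[OF assms]
    by (simp add: current_jacobian_def jacobian_works)
  then have D: "((\<lambda>x. ?f x $ i) has_derivative (\<lambda>h. (?J *v h) $ i)) (at (vector [\<rho>, \<E>]))"
    by (rule bounded_linear.has_derivative[OF bounded_linear_vec_nth])
  have line: "((\<lambda>t. ?f (vector [\<rho>, \<E>] + (t - s) *\<^sub>R axis k 1) $ i)
      has_real_derivative ?J $ i $ k) (at s)" for s k
  proof -
    have "((\<lambda>t::real. vector [\<rho>, \<E>] + (t - s) *\<^sub>R axis k 1 :: real^2)
        has_derivative (\<lambda>t. t *\<^sub>R axis k 1)) (at s)"
      by (auto intro!: derivative_eq_intros)
    from has_derivative_compose[OF this, of "\<lambda>x. ?f x $ i" "\<lambda>h. (?J *v h) $ i"] D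
    show ?thesis
      by (simp add: has_field_derivative_def scaleR_matrix_vector_assoc[symmetric]
        matrix_vector_mult_scaleR matrix_vector_mult_basis column_def mult.commute[of "?J $ i $ k"]
        mult_commute_abs)
  qed
  show "((\<lambda>r. macroscopic_current \<kappa> \<alpha>p \<alpha>e r \<E> $ i) has_real_derivative ?J $ i $ 1) (at \<rho>)"
    using line[of \<rho> 1] by (simp add: axis_def)
  show "((\<lambda>e. macroscopic_current \<kappa> \<alpha>p \<alpha>e \<rho> e $ i) has_real_derivative ?J $ i $ 2) (at \<E>)"
    using line[of \<E> 2] by (simp add: axis_def)
qed

end

theory Submission
  imports Defs
begin

text \<open>The Jacobian satisfies the Onsager-type relation that \<open>J \<chi>\<close> is symmetric. Since \<open>\<chi>\<close> is
  positive definite, \<open>J\<close> is then self-adjoint for an inner product, which gives the orthogonality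
  of left eigenvectors and, for a \<open>2 \<times> 2\<close> matrix, a positive discriminant unless \<open>J\<close> is scalar.
  The entries of the first row and the lower left entry show that \<open>J\<close> is scalar only for
  \<open>\<alpha>p = \<alpha>e = 0\<close>.\<close>

text \<open>The inequation is the nonvanishing of the determinant of the matrix \<open>P\<close>
  with columns \<open>x\<close> and \<open>y\<close>, and the eigenvector equations amount to
  \<open>A ** P = P ** D\<close>.\<close>

lemma diagonalizable_2I:
  fixes A :: "'a::field^2^2"
  assumes "A *v x = l *s x" "A *v y = m *s y" "x$1 * y$2 \<noteq> y$1 * x$2"
  shows "diagonalizable A"
proof -
  define P :: "'a^2^2" where "P = vector [vector [x$1, y$1], vector [x$2, y$2]]"
  define D :: "'a^2^2" where "D = vector [vector [l, 0], vector [0, m]]"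
  have inv: "invertible P"
    using assms(3) by (simp add: invertible_det_nz det_2 P_def)
  then have inv_right: "P ** matrix_inv P = mat 1"
    unfolding invertible_def matrix_inv_def by (metis (mono_tags, lifting) someI_ex)
  have "A ** P = P ** D"
    using assms(1,2)
    by (simp add: vec_eq_iff forall_2 matrix_vector_mult_def matrix_matrix_mult_def sum_2
        P_def D_def mult.commute)
  then have "A = P ** D ** matrix_inv P"
    using inv_right by (metis matrix_mul_assoc matrix_mul_rid)
  moreover have "\<forall>i j. i \<noteq> j \<longrightarrow> D $ i $ j = 0"
    by (simp add: forall_2 D_def)
  ultimately show ?thesis
    using inv unfolding diagonalizable_def by blast
qed

lemma eigenvalue_iff_det:
  fixes A :: "'a::field^'n^'n"
  shows "eigenvalue A l \<longleftrightarrow> det (A - mat l) = 0"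
proof -
  have "mat l *v x = l *s x" for x :: "'a^'n"
    by (simp add: vec_eq_iff matrix_vector_mult_def mat_def if_distrib[of "\<lambda>z. z * _"] cong: if_cong)
  then have "A *v x = l *s x \<longleftrightarrow> (A - mat l) *v x = 0" for x
    by (simp add: matrix_vector_mult_diff_rdistrib)
  then show ?thesis
    unfolding eigenvalue_def using invertible_det_nz[of "A - mat l"]
      invertible_left_inverse[of "A - mat l"] matrix_left_invertible_ker[of "A - mat l"]
    by auto
qed

lemma eigenvalue_2_iff:
  fixes A :: "'a::field^2^2"
  shows "eigenvalue A l \<longleftrightarrow> (A$1$1 - l) * (A$2$2 - l) = A$1$2 * A$2$1"
  by (simp add: eigenvalue_iff_det det_2 mat_def)

text \<open>The assumed positive quantity is the squared trace minus four times the determinant, the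
  discriminant of the characteristic polynomial. Its roots \<open>l\<close> and \<open>m\<close> are
  thus real and distinct.\<close>

lemma pos_discriminant_2:
  fixes A :: "real^2^2"
  assumes "(A$1$1 - A$2$2)\<^sup>2 + 4 * A$1$2 * A$2$1 > 0"
  shows "diagonalizable A" and "card {l. eigenvalue A l} = 2"
proof -
  define s where "s = sqrt ((A$1$1 - A$2$2)\<^sup>2 + 4 * A$1$2 * A$2$1)"
  define l where "l = (A$1$1 + A$2$2 + s) / 2"
  define m where "m = (A$1$1 + A$2$2 - s) / 2"
  have s2: "s\<^sup>2 = (A$1$1 - A$2$2)\<^sup>2 + 4 * A$1$2 * A$2$1" and s0: "s > 0"
    using assms by (auto simp: s_def)
  have neq: "l \<noteq> m"
    using s0 by (simp add: l_def m_def)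
  have factor: "(A$1$1 - t) * (A$2$2 - t) - A$1$2 * A$2$1 = (t - l) * (t - m)" for t
    using s2 by (simp add: l_def m_def field_simps power2_eq_square)
  have "eigenvalue A t \<longleftrightarrow> t = l \<or> t = m" for t
    using factor[of t] by (auto simp: eigenvalue_2_iff)
  then have "{t. eigenvalue A t} = {l, m}"
    by auto
  then show "card {l. eigenvalue A l} = 2"
    using neq by simp
  show "diagonalizable A"
  proof (cases "A$1$2 = 0")
    case True
    show ?thesis
    \<comment> \<open>Here \<open>A\<close> is lower triangular, and the discriminant is the square
      of the difference of its diagonal entries, which are therefore distinct.\<close>
    proof (rule diagonalizable_2I)
      show "A *v vector [A$1$1 - A$2$2, A$2$1] = (A$1$1) *s vector [A$1$1 - A$2$2, A$2$1]"
        using True by (simp add: vec_eq_iff forall_2 matrix_vector_mult_def sum_2 algebra_simps)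
      show "A *v vector [0, 1] = (A$2$2) *s vector [0, 1]"
        using True by (simp add: vec_eq_iff forall_2 matrix_vector_mult_def sum_2)
      show "vector [A$1$1 - A$2$2, A$2$1] $ 1 * (vector [0, 1] :: real^2) $ 2
          \<noteq> (vector [0, 1] :: real^2) $ 1 * vector [A$1$1 - A$2$2, A$2$1] $ 2"
        using True assms by auto
    qed
  next
    case False
    \<comment> \<open>The first coordinate of this equation holds for every \<open>t\<close>; the
      second one is the characteristic equation.\<close>
    have ev: "A *v vector [A$1$2, t - A$1$1] = t *s vector [A$1$2, t - A$1$1]"
      if "t = l \<or> t = m" for t
      using that factor[of t]
      by (auto simp: vec_eq_iff forall_2 matrix_vector_mult_def sum_2 algebra_simps)
    show ?thesis
      by (rule diagonalizable_2I[OF ev[of l] ev[of m]]) (use False neq in auto)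
  qed
qed

lemma scalar_2_diagonalizable:
  fixes A :: "'a::field^2^2"
  assumes "A$1$1 = A$2$2" "A$1$2 = 0" "A$2$1 = 0"
  shows "diagonalizable A"
proof (rule diagonalizable_2I)
  show "A *v vector [1, 0] = (A$1$1) *s vector [1, 0]" "A *v vector [0, 1] = (A$1$1) *s vector [0, 1]"
    using assms by (simp_all add: vec_eq_iff forall_2 matrix_vector_mult_def sum_2)
qed simp

lemma pos_discriminant_of_symmetrizer:
  fixes A X :: "real^2^2"
  assumes sym: "transpose X = X" "transpose (A ** X) = A ** X"
    and pos: "X$1$1 > 0" "det X > 0"
    and nonscalar: "\<not> (A$1$1 = A$2$2 \<and> A$1$2 = 0 \<and> A$2$1 = 0)"
  shows "(A$1$1 - A$2$2)\<^sup>2 + 4 * A$1$2 * A$2$1 > 0"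
proof -
  define a b c d x y z where defs: "a = A$1$1" "b = A$1$2" "c = A$2$1" "d = A$2$2"
    "x = X$1$1" "y = X$1$2" "z = X$2$2"
  have X21: "X$2$1 = y"
    using arg_cong[OF sym(1), of "\<lambda>M. M$1$2"] by (simp add: transpose_def defs)
  have "a * y + b * z = c * x + d * y"
    using arg_cong[OF sym(2), of "\<lambda>M. M$2$1"] X21
    by (simp add: transpose_def matrix_matrix_mult_def sum_2 defs)
  \<comment> \<open>Symmetry of \<open>A ** X\<close> thus allows \<open>c\<close> to be eliminated
    after multiplication by \<open>x\<close>.\<close>
  then have cx: "c * x = (a - d) * y + b * z"
    by (simp add: algebra_simps)
  have x: "x > 0" and det: "x * z - y * y > 0"
    using pos X21 by (auto simp: det_2 defs)
  \<comment> \<open>The discriminant is, up to a positive factor, the form \<open>X\<close> evaluated at \<open>(a - d, 2 b)\<close>.\<close>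
  have "x * x * ((a - d)\<^sup>2 + 4 * b * c) = x * x * (a - d)\<^sup>2 + 4 * b * x * (c * x)"
    by (simp add: algebra_simps)
  also have "\<dots> = (x * (a - d) + 2 * y * b)\<^sup>2 + (2 * b)\<^sup>2 * (x * z - y * y)"
    unfolding cx by (simp add: power2_eq_square algebra_simps)
  also have "\<dots> > 0"
  proof (cases "b = 0")
    case True
    \<comment> \<open>With \<open>b = 0\<close>, the equality \<open>a = d\<close> would give
      \<open>c * x = 0\<close>, hence \<open>c = 0\<close> and a scalar matrix.\<close>
    then have "a \<noteq> d"
      using nonscalar cx x by (auto simp flip: defs)
    then show ?thesis
      using True x by simp
  next
    case False
    then show ?thesis
      using det by (intro add_nonneg_pos mult_pos_pos) auto
  qed
  finally show ?thesis
    using x by (simp add: zero_less_mult_iff defs)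
qed

text \<open>Evaluating the symmetric form \<open>A ** X\<close> at \<open>u\<close> and
  \<open>v\<close> from either side yields \<open>l\<close> times and \<open>m\<close> times the
  same number, the form \<open>X\<close> at \<open>u\<close> and \<open>v\<close>.\<close>

lemma left_eigenvectors_orthogonal:
  fixes A X :: "real^'n^'n"
  assumes sym: "transpose X = X" "transpose (A ** X) = A ** X"
    and u: "left_eigenvector A u l" and v: "left_eigenvector A v m" and "l \<noteq> m"
  shows "(u v* X) \<bullet> v = 0"
proof -
  have "l * ((u v* X) \<bullet> v) = (u v* (A ** X)) \<bullet> v"
    using u by (simp add: left_eigenvector_def vector_matrix_mul_assoc[symmetric]
        scalar_mult_eq_scaleR scaleR_vector_matrix_assoc)
  also have "\<dots> = (v v* (A ** X)) \<bullet> u"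
    by (metis dot_lmul_matrix inner_commute sym(2) transpose_matrix_vector)
  also have "\<dots> = m * ((v v* X) \<bullet> u)"
    using v by (simp add: left_eigenvector_def vector_matrix_mul_assoc[symmetric]
        scalar_mult_eq_scaleR scaleR_vector_matrix_assoc)
  also have "(v v* X) \<bullet> u = (u v* X) \<bullet> v"
    by (metis dot_lmul_matrix inner_commute sym(1) transpose_matrix_vector)
  finally show ?thesis
    using \<open>l \<noteq> m\<close> by simp
qed

lemma transpose_compressibility: "transpose (compressibility \<kappa> \<rho> \<E>) = compressibility \<kappa> \<rho> \<E>"
  by (simp add: vec_eq_iff forall_2 transpose_def compressibility_def)

text \<open>The last summand of the lower right entry cancels against the off-diagonal product. In
  the remaining product every factor is positive on the domain of the theorem, as positive
  definiteness requires.\<close>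

lemma det_compressibility:
  assumes "\<rho> \<noteq> 0" "\<kappa> \<ge> 2"
  shows "det (compressibility \<kappa> \<rho> \<E>) = (1 - \<rho>) * (\<E> - \<rho>) * (real \<kappa> * \<rho> - \<E>) / (real \<kappa> - 1)"
proof -
  have "real \<kappa> - 1 \<noteq> 0"
    using assms(2) by linarith
  with assms(1) show ?thesis
    by (simp add: det_2 compressibility_def field_simps power2_eq_square)
qed

lemma current_jacobian_entries:
  assumes "\<rho> \<noteq> 0" "\<kappa> \<ge> 2"
  shows "current_jacobian \<kappa> \<alpha>p \<alpha>e \<rho> \<E> $ 1 $ 1 = (real \<kappa> - 1) * ((1 - 2 * \<rho>) * \<alpha>p - \<E> * \<alpha>e)" (is ?J11)
    and "current_jacobian \<kappa> \<alpha>p \<alpha>e \<rho> \<E> $ 1 $ 2 = (real \<kappa> - 1) * (1 - \<rho>) * \<alpha>e" (is ?J12)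
    and "current_jacobian \<kappa> \<alpha>p \<alpha>e \<rho> \<E> $ 2 $ 1 =
      - (real \<kappa> - 1) * \<E> * \<alpha>p - ((real \<kappa> - 2) * \<E>\<^sup>2 / \<rho>\<^sup>2 + real \<kappa>) * \<alpha>e" (is ?J21)
    and "current_jacobian \<kappa> \<alpha>p \<alpha>e \<rho> \<E> $ 2 $ 2 = (real \<kappa> - 1) * (1 - \<rho>) * \<alpha>p
      + (2 * (real \<kappa> - 2) * \<E> / \<rho> + real \<kappa> + 1 - 2 * (real \<kappa> - 1) * \<E>) * \<alpha>e" (is ?J22)
proof -
  \<comment> \<open>Substituting \<open>k + 1\<close> for \<kappa> turns the denominator \<kappa> -
    1 into the nonzero atom \<open>k\<close>, which \<open>field_simps\<close> can clear.\<close>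
  obtain k where k: "real \<kappa> = k + 1" "k \<noteq> 0"
    using assms(2) that[of "real \<kappa> - 1"] by simp
  note partial = current_jacobian_partial[OF assms, of \<alpha>p \<alpha>e]
  note expand = macroscopic_current_def compressibility_def matrix_vector_mult_def sum_2
  show ?J11
    by (rule DERIV_unique[OF partial(1)[of \<E> 1]])
       (auto simp: expand field_simps intro!: derivative_eq_intros)
  show ?J12
    by (rule DERIV_unique[OF partial(2)[of 1 \<E>]])
       (auto simp: expand field_simps intro!: derivative_eq_intros)
  show ?J21
    by (rule DERIV_unique[OF partial(1)[of \<E> 2]])
       (use assms(1) k in \<open>auto simp: expand field_simps power2_eq_square intro!: derivative_eq_intros\<close>)
  show ?J22
    by (rule DERIV_unique[OF partial(2)[of 2 \<E>]])
       (use assms(1) k in \<open>auto simp: expand field_simps power2_eq_square intro!: derivative_eq_intros\<close>)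
qed

text \<open>Conceptually, \<chi> is the Hessian of a log-partition function in the chemical
  potentials whose gradient is (\<rho>, \<E>). By the chain rule, \<open>JX\<close> is then its
  third derivative contracted with a fixed vector, hence symmetric. The proof checks this on the
  explicit entries.\<close>

lemma current_jacobian_compressibility_symmetric:
  fixes \<alpha>p \<alpha>e \<E> :: real
  assumes "\<rho> \<noteq> 0" "\<kappa> \<ge> 2"
  defines "JX \<equiv> current_jacobian \<kappa> \<alpha>p \<alpha>e \<rho> \<E> ** compressibility \<kappa> \<rho> \<E>"
  shows "transpose JX = JX"
proof -
  obtain k where k: "real \<kappa> = k + 1" "k \<noteq> 0"
    using assms(2) that[of "real \<kappa> - 1"] by simp
  then have "JX $ 1 $ 2 = JX $ 2 $ 1"
    using assms(1)
    by (simp add: JX_def matrix_matrix_mult_def sum_2 current_jacobian_entries[OF assms(1,2)]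
        compressibility_def field_simps power2_eq_square)
  then show ?thesis
    by (simp add: vec_eq_iff forall_2 transpose_def)
qed

theorem theorem11:
  fixes \<kappa> :: nat and \<alpha>p \<alpha>e \<rho> \<E> :: real
  assumes "\<kappa> \<ge> 2"
    and "\<rho> \<in> {0<..<1}"
    and "\<E> \<in> {\<rho><..<real \<kappa> * \<rho>}"
  shows "diagonalizable (current_jacobian \<kappa> \<alpha>p \<alpha>e \<rho> \<E>)
    \<and> ((\<alpha>p, \<alpha>e) \<noteq> (0, 0) \<longrightarrow> card {l. eigenvalue (current_jacobian \<kappa> \<alpha>p \<alpha>e \<rho> \<E>) l} = 2)
    \<and> (\<forall>u v l m. left_eigenvector (current_jacobian \<kappa> \<alpha>p \<alpha>e \<rho> \<E>) u l
          \<and> left_eigenvector (current_jacobian \<kappa> \<alpha>p \<alpha>e \<rho> \<E>) v m \<and> l \<noteq> m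
          \<longrightarrow> (u v* compressibility \<kappa> \<rho> \<E>) \<bullet> v = 0)"
proof -
  let ?J = "current_jacobian \<kappa> \<alpha>p \<alpha>e \<rho> \<E>" and ?X = "compressibility \<kappa> \<rho> \<E>"
  have \<rho>: "\<rho> \<noteq> 0" "0 < \<rho>" "\<rho> < 1" and \<E>: "\<rho> < \<E>" "\<E> < real \<kappa> * \<rho>" and k: "real \<kappa> - 1 > 0"
    using assms by auto
  note symX = transpose_compressibility[of \<kappa> \<rho> \<E>]
  note symJX = current_jacobian_compressibility_symmetric[OF \<rho>(1) assms(1), of \<alpha>p \<alpha>e \<E>]
  note entries = current_jacobian_entries[OF \<rho>(1) assms(1), of \<alpha>p \<alpha>e \<E>]
  have "?X $ 1 $ 1 > 0"
    using \<rho> by (simp add: compressibility_def)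
  moreover have "det ?X > 0"
    using \<rho> \<E> k by (simp add: det_compressibility[OF \<rho>(1) assms(1)])
  ultimately have disc: "(?J$1$1 - ?J$2$2)\<^sup>2 + 4 * ?J$1$2 * ?J$2$1 > 0"
    if "\<not> (?J$1$1 = ?J$2$2 \<and> ?J$1$2 = 0 \<and> ?J$2$1 = 0)"
    using pos_discriminant_of_symmetrizer[OF symX symJX] that by blast
  have nonscalar: "\<not> (?J$1$1 = ?J$2$2 \<and> ?J$1$2 = 0 \<and> ?J$2$1 = 0)" if "(\<alpha>p, \<alpha>e) \<noteq> (0, 0)"
  proof (cases "\<alpha>e = 0")
    case True
    \<comment> \<open>For \<open>\<alpha>e = 0\<close> this entry reduces to
      \<open>- (real \<kappa> - 1) * \<E> * \<alpha>p\<close>.\<close>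
    then have "?J$2$1 \<noteq> 0"
      using that \<rho> \<E> k entries(3) by simp
    then show ?thesis
      by simp
  next
    case False
    then have "?J$1$2 \<noteq> 0"
      using \<rho> k entries(2) by simp
    then show ?thesis
      by simp
  qed
  \<comment> \<open>A scalar Jacobian has discriminant zero, so that case is treated
    separately.\<close>
  have "diagonalizable ?J"
    using disc pos_discriminant_2(1) scalar_2_diagonalizable by blast
  moreover have "card {l. eigenvalue ?J l} = 2" if "(\<alpha>p, \<alpha>e) \<noteq> (0, 0)"
    using disc[OF nonscalar[OF that]] by (rule pos_discriminant_2(2))
  ultimately show ?thesis
    using left_eigenvectors_orthogonal[OF symX symJX] by blast
qed

end
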